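(* Suppose $G$ is a group of order $n$. If there is an $(s,t)$-$\lambda$-fold near-factorization of $G$, then $$\lambda\le\left\lfloor\frac{n+1}{4}\right\rfloor.$$
   Context: For subsets $S,T$ of a finite group $G$ with identity $e$, and a positive integer $\lambda$, $(S,T)$ is a $\lambda$-fold near-factorization of $G$ if every non-identity element $g\in G$ can be written as $g=xy$ with $x\in S$, $y\in T$ in exactly $\lambda$ ways, and $xy\neq e$ for all $x\in S$, $y\in T$. It is an $(s,t)$-$\lambda$-fold near-factorization if moreover $|S|=s$ and $|T|=t$.
   Formalization: The hypothesis n ≥ 3 is added: for n = 1 (S, T empty) and n = 2 (S = {e}, T = {g}, λ = 1) near-factorizations exist but the bound ⌊(n+1)/4⌋ is 0 while λ ≥ 1, so the printed claim fails there. *)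

theory Defs
  imports "HOL-Algebra.Algebra"
begin

definition near_factorization ::
    "('a, 'b) monoid_scheme \<Rightarrow> nat \<Rightarrow> 'a set \<Rightarrow> 'a set \<Rightarrow> bool"
  where
  "near_factorization G l S T \<longleftrightarrow>
     0 < l \<and> S \<subseteq> carrier G \<and> T \<subseteq> carrier G \<and>
     (\<forall>g \<in> carrier G - {\<one>\<^bsub>G\<^esub>}.
        card {(x, y). x \<in> S \<and> y \<in> T \<and> x \<otimes>\<^bsub>G\<^esub> y = g} = l) \<and>
     (\<forall>x \<in> S. \<forall>y \<in> T. x \<otimes>\<^bsub>G\<^esub> y \<noteq> \<one>\<^bsub>G\<^esub>)"

definition st_near_factorization ::
    "('a, 'b) monoid_scheme \<Rightarrow> nat \<Rightarrow> nat \<Rightarrow> nat \<Rightarrow> 'a set \<Rightarrow> 'a set \<Rightarrow> bool"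
  where
  "st_near_factorization G s t l S T \<longleftrightarrow>
     near_factorization G l S T \<and> card S = s \<and> card T = t"

end

(* Counting products gives s t = l (n - 1), and S\<inverse> is disjoint from T, so s + t \<le> n.
   By AM-GM 4 l (n - 1) \<le> n\<^sup>2 < (n + 2) (n - 1) once n \<ge> 3, hence 4 l \<le> n + 1. *)

theory Submission
  imports Defs
begin

text \<open>Two counts pin down s and t: their product is l * (n - 1)
  (\<open>near_factorization_card_mult\<close>) and their sum is at most n
  (\<open>near_factorization_card_add\<close>). A product with bounded sum is largest when the
  factors are equal, so 4 * l * (n - 1) \<le> n^2 = (n - 1) * (n + 1) + 1. For n \<ge> 3 the extra 1
  is less than n - 1, and integrality gives 4 * l \<le> n + 1.\<close>

text \<open>Multiplication splits S x T into fibres: the one over the identity is empty, each of the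
  others has l pairs.\<close>

lemma near_factorization_card_mult:
  assumes "group G" and fin: "finite (carrier G)" and nf: "near_factorization G l S T"
  shows "card S * card T = l * (order G - 1)"
proof -
  interpret group G by fact
  have sub: "S \<subseteq> carrier G" "T \<subseteq> carrier G"
    and fib: "\<And>g. g \<in> carrier G - {\<one>\<^bsub>G\<^esub>} \<Longrightarrow>
      card {(x, y). x \<in> S \<and> y \<in> T \<and> x \<otimes>\<^bsub>G\<^esub> y = g} = l"
    and ne: "\<And>x y. x \<in> S \<Longrightarrow> y \<in> T \<Longrightarrow> x \<otimes>\<^bsub>G\<^esub> y \<noteq> \<one>\<^bsub>G\<^esub>"
    using nf unfolding near_factorization_def by auto
  let ?f = "\<lambda>(x, y). x \<otimes>\<^bsub>G\<^esub> y"
  have "finite (S \<times> T)"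
    using sub fin by (auto intro: finite_subset)
  moreover have "?f ` (S \<times> T) \<subseteq> carrier G - {\<one>\<^bsub>G\<^esub>}"
    using sub ne by auto
  ultimately have "card (S \<times> T) =
      (\<Sum>g\<in>carrier G - {\<one>\<^bsub>G\<^esub>}. card {p \<in> S \<times> T. ?f p = g})"
    \<comment> \<open>Summing the constant 1 fibre by fibre turns \<open>sum.group\<close> into a
      count of pairs.\<close>
    using sum.group[of "S \<times> T" "carrier G - {\<one>\<^bsub>G\<^esub>}" ?f "\<lambda>_. 1::nat"] fin by simp
  also have "\<dots> = (\<Sum>g\<in>carrier G - {\<one>\<^bsub>G\<^esub>}. l)"
  proof (rule sum.cong)
    fix g assume "g \<in> carrier G - {\<one>\<^bsub>G\<^esub>}"
    moreover have "{p \<in> S \<times> T. ?f p = g} = {(x, y). x \<in> S \<and> y \<in> T \<and> x \<otimes>\<^bsub>G\<^esub> y = g}"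
      by auto
    ultimately show "card {p \<in> S \<times> T. ?f p = g} = l"
      using fib by simp
  qed simp
  finally show ?thesis
    by (simp add: card_cartesian_product order_def)
qed

text \<open>If the inverse of some x in S lay in T, the two would multiply to the identity. So T
  misses the set of inverses of S, which has as many elements as S.\<close>

lemma near_factorization_card_add:
  assumes "group G" and fin: "finite (carrier G)" and nf: "near_factorization G l S T"
  shows "card S + card T \<le> order G"
proof -
  interpret group G by fact
  have sub: "S \<subseteq> carrier G" "T \<subseteq> carrier G"
    and ne: "\<And>x y. x \<in> S \<Longrightarrow> y \<in> T \<Longrightarrow> x \<otimes>\<^bsub>G\<^esub> y \<noteq> \<one>\<^bsub>G\<^esub>"
    using nf unfolding near_factorization_def by auto
  have fins: "finite S" "finite T"
    using sub fin by (auto intro: finite_subset)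
  have "m_inv G ` S \<inter> T = {}"
    using ne sub by fastforce
  then have "card (m_inv G ` S) + card T = card (m_inv G ` S \<union> T)"
    using fins by (simp add: card_Un_disjoint)
  also have "\<dots> \<le> card (carrier G)"
    using sub fin by (intro card_mono) auto
  finally show ?thesis
    using inj_on_subset[OF inv_inj sub(1)] by (simp add: card_image order_def)
qed

theorem corollary1p19:
  fixes G :: "('a, 'b) monoid_scheme" and n s t l :: nat
  assumes "group G" and "finite (carrier G)" and "order G = n"
    and "n \<ge> 3"
    and "\<exists>S T. st_near_factorization G s t l S T"
  shows "int l \<le> \<lfloor>(real n + 1) / 4\<rfloor>"
proof -
  obtain S T where "near_factorization G l S T" "card S = s" "card T = t"
    using assms(5) unfolding st_near_factorization_def by blast
  then have st: "s * t = l * (n - 1)" and "s + t \<le> n"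
    using near_factorization_card_mult near_factorization_card_add assms(1-3) by blast+
  \<comment> \<open>Writing n as m + 3 removes the truncated subtraction in n - 1.\<close>
  obtain m where n: "n = m + 3"
    using assms(4) le_Suc_ex by (metis add.commute)
  \<comment> \<open>AM-GM, done in the integers because s - t may be negative.\<close>
  have "4 * (int s * int t) = (int s + int t)\<^sup>2 - (int s - int t)\<^sup>2"
    by (simp add: power2_eq_square algebra_simps)
  also have "\<dots> \<le> (int s + int t)\<^sup>2"
    by simp
  also have "\<dots> \<le> (int n)\<^sup>2"
    using \<open>s + t \<le> n\<close> by (intro power_mono) auto
  finally have "4 * (int s * int t) \<le> (int n)\<^sup>2"
    by simp
  then have "int (4 * (s * t)) \<le> int (n\<^sup>2)"
    by simp
  then have "4 * (s * t) \<le> n\<^sup>2"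
    by (simp only: of_nat_le_iff)
  then have bound: "(4 * l) * (m + 2) \<le> (m + 3)\<^sup>2"
    unfolding st n by (simp add: algebra_simps)
  have "4 * l \<le> n + 1"
  proof (rule ccontr)
    assume "\<not> 4 * l \<le> n + 1"
    \<comment> \<open>Here m + 5 is n + 2, and (n + 2) * (n - 1) = n^2 + n - 2 exceeds n^2 as soon
      as n > 2.\<close>
    then have "(m + 5) * (m + 2) \<le> (4 * l) * (m + 2)"
      using n by (intro mult_right_mono) auto
    with bound show False
      by (simp add: power2_eq_square algebra_simps)
  qed
  then show ?thesis
    by (simp add: le_floor_iff)
qed

end
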